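(* Let $\omega$ be a symplectic form on $\mathbb{R}^{2n}$ (a non-degenerate skew-symmetric bilinear form), and let $\nabla$ and $\nabla'$ be two affine structures on $\mathbb{R}^{2n}$, both compatible with $\omega$, satisfying in addition $$\nabla_x\nabla'_y=\nabla_y\nabla'_x\qquad\text{for all }x,y\in\mathbb{R}^{2n}.$$ Then $\mathbb{R}^{4n}=\mathbb{R}^{2n}\times\mathbb{R}^{2n}$ with the product $$(x,x')\cdot(y,y')=\bigl(x+\alpha(x',y),\ \beta(x',y)+y'\bigr),\qquad x,x',y,y'\in\mathbb{R}^{2n},$$ where $$\alpha(x',y)=y+\nabla'_yx'-\tfrac12\nabla'_y\nabla_yx',\qquad \beta(x',y)=x'-\nabla_{x'}y-\tfrac12\nabla_{x'}\nabla'_{x'}y,$$ is a Lie group such that $(\mathbb{R}^{4n},\ \mathbb{R}^{2n}\times\{0\},\ \{0\}\times\mathbb{R}^{2n})$ is a double Lie group, and it is nilpotent of step at most $3$. Furthermore, the associated Lie bracket on its Lie algebra $\mathbb{R}^{2n}\oplus\mathbb{R}^{2n}$ is $$[(x,x'),(y,y')]=\bigl(\nabla'_yx'-\nabla'_xy',\ \nabla_xy'-\nabla_yx'\bigr).$$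
   Context: An affine structure on $\mathbb{R}^m$ is a bilinear map $\nabla:\mathbb{R}^m\times\mathbb{R}^m\to\mathbb{R}^m$, $(x,y)\mapsto\nabla_xy$, such that $\nabla_xy=\nabla_yx$ and $\nabla_x\nabla_y=\nabla_y\nabla_x$ (as endomorphisms of $\mathbb{R}^m$) for all $x,y\in\mathbb{R}^m$. It is compatible with a non-degenerate skew-symmetric bilinear form $\omega$ on $\mathbb{R}^m$ if $\omega(\nabla_xy,z)=\omega(\nabla_xz,y)$ for all $x,y,z\in\mathbb{R}^m$. Juxtaposition denotes composition of endomorphisms, e.g. $\nabla'_y\nabla_yx'=\nabla'_y(\nabla_yx')$. A double Lie group is a triple $(G,G_+,G_-)$ of Lie groups such that $G_+$ and $G_-$ are Lie subgroups of $G$ and the map $G_+\times G_-\to G$, $(g_+,g_-)\mapsto g_+g_-$, is a diffeomorphism. The Lie algebra of the group is identified as a vector space with the tangent space $\mathbb{R}^{2n}\oplus\mathbb{R}^{2n}$ at the neutral element $(0,0)$, with the bracket of left-invariant vector fields. *)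

theory Defs
  imports "HOL-Analysis.Analysis" "HOL-Algebra.Generated_Groups"
begin

definition affine_structure :: "('a::real_vector \<Rightarrow> 'a \<Rightarrow> 'a) \<Rightarrow> bool" where
  "affine_structure nab \<longleftrightarrow>
     bilinear nab \<and>
     (\<forall>x y. nab x y = nab y x) \<and>
     (\<forall>x y. nab x \<circ> nab y = nab y \<circ> nab x)"

definition symplectic_form :: "('a::real_vector \<Rightarrow> 'a \<Rightarrow> real) \<Rightarrow> bool" where
  "symplectic_form \<omega> \<longleftrightarrow>
     bilinear \<omega> \<and>
     (\<forall>x y. \<omega> x y = - \<omega> y x) \<and>
     (\<forall>x. (\<forall>y. \<omega> x y = 0) \<longrightarrow> x = 0)"

definition compatible :: "('a \<Rightarrow> 'a \<Rightarrow> 'a) \<Rightarrow> ('a \<Rightarrow> 'a \<Rightarrow> real) \<Rightarrow> bool" where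
  "compatible nab \<omega> \<longleftrightarrow> (\<forall>x y z. \<omega> (nab x y) z = \<omega> (nab x z) y)"

text \<open>
  In finite dimension, being of class \<open>C\<^sup>k\<close> on an open set amounts to being \<open>k\<close> times
  differentiable along constant directions with continuous \<open>k\<close>-th derivatives. Recursing through
  directional derivatives keeps the codomain type fixed.
\<close>

primrec Ck_on_open ::
    "nat \<Rightarrow> 'a::euclidean_space set \<Rightarrow> ('a \<Rightarrow> 'b::euclidean_space) \<Rightarrow> bool" where
  "Ck_on_open 0 U f \<longleftrightarrow> continuous_on U f"
| "Ck_on_open (Suc k) U f \<longleftrightarrow>
     (\<forall>x\<in>U. f differentiable (at x)) \<and>
     (\<forall>v. Ck_on_open k U (\<lambda>x. frechet_derivative f (at x) v))"

text \<open>
  Smoothness on an arbitrary subset is the existence of local smooth extensions to open sets of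
  the ambient space; for an embedded submanifold this is the intrinsic notion of smoothness.
\<close>

definition smooth_map_on ::
    "'a::euclidean_space set \<Rightarrow> ('a \<Rightarrow> 'b::euclidean_space) \<Rightarrow> bool" where
  "smooth_map_on S f \<longleftrightarrow>
     (\<forall>x\<in>S. \<exists>U g. open U \<and> x \<in> U \<and> (\<forall>k. Ck_on_open k U g) \<and> (\<forall>y\<in>S \<inter> U. g y = f y))"

definition diffeomorphism_on ::
    "'a::euclidean_space set \<Rightarrow> 'b::euclidean_space set \<Rightarrow> ('a \<Rightarrow> 'b) \<Rightarrow> bool" where
  "diffeomorphism_on S T f \<longleftrightarrow>
     bij_betw f S T \<and> smooth_map_on S f \<and> smooth_map_on T (inv_into S f)"

text \<open>The fixed linear subspace \<open>W\<close> is the model space of the submanifold.\<close>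

definition embedded_submanifold :: "'a::euclidean_space set \<Rightarrow> bool" where
  "embedded_submanifold S \<longleftrightarrow>
     (\<exists>W. subspace W \<and>
       (\<forall>x\<in>S. \<exists>U V (\<phi> :: 'a \<Rightarrow> 'a).
          open U \<and> x \<in> U \<and> open V \<and> diffeomorphism_on U V \<phi> \<and> \<phi> ` (S \<inter> U) = W \<inter> V))"

definition lie_group :: "'a::euclidean_space monoid \<Rightarrow> bool" where
  "lie_group G \<longleftrightarrow>
     group G \<and>
     embedded_submanifold (carrier G) \<and>
     smooth_map_on (carrier G \<times> carrier G) (\<lambda>(g, h). g \<otimes>\<^bsub>G\<^esub> h) \<and>
     smooth_map_on (carrier G) (\<lambda>g. inv\<^bsub>G\<^esub> g)"

text \<open>
  Lie subgroups are taken to be embedded. In the definition of a double Lie group this is no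
  restriction on the two subgroups, since the product map being a diffeomorphism onto \<open>G\<close>
  embeds both of them.
\<close>

definition lie_subgroup :: "'a::euclidean_space set \<Rightarrow> 'a monoid \<Rightarrow> bool" where
  "lie_subgroup H G \<longleftrightarrow> subgroup H G \<and> embedded_submanifold H"

definition double_lie_group ::
    "'a::euclidean_space monoid \<Rightarrow> 'a set \<Rightarrow> 'a set \<Rightarrow> bool" where
  "double_lie_group G Gp Gm \<longleftrightarrow>
     lie_group G \<and> lie_subgroup Gp G \<and> lie_subgroup Gm G \<and>
     diffeomorphism_on (Gp \<times> Gm) (carrier G) (\<lambda>(g, h). g \<otimes>\<^bsub>G\<^esub> h)"

text \<open>
  Lower central series, indexed from \<open>0\<close>: the \<open>0\<close>-th term is the whole group and the next term is
  the subgroup generated by commutators with the previous one. Nilpotency of step at most \<open>k\<close>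
  means that the \<open>k\<close>-th term is trivial, so step at most \<open>1\<close> means abelian.
\<close>

primrec lower_central_series :: "('a, 'b) monoid_scheme \<Rightarrow> nat \<Rightarrow> 'a set" where
  "lower_central_series G 0 = carrier G"
| "lower_central_series G (Suc k) =
     generate G (\<Union>g \<in> carrier G. \<Union>h \<in> lower_central_series G k.
       {g \<otimes>\<^bsub>G\<^esub> h \<otimes>\<^bsub>G\<^esub> inv\<^bsub>G\<^esub> g \<otimes>\<^bsub>G\<^esub> inv\<^bsub>G\<^esub> h})"

definition nilpotent_of_step_le :: "nat \<Rightarrow> ('a, 'b) monoid_scheme \<Rightarrow> bool" where
  "nilpotent_of_step_le k G \<longleftrightarrow> lower_central_series G k = {\<one>\<^bsub>G\<^esub>}"

text \<open>
  The bracket notions below are meant for Lie groups whose carrier is open in the ambient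
  space, so that every tangent space is the ambient space itself. The bracket of vector fields is
  the commutator of derivations, \<open>[X, Y] f = X (Y f) - Y (X f)\<close>, written in the global coordinates.
\<close>

definition vector_field_bracket ::
    "('a::euclidean_space \<Rightarrow> 'a) \<Rightarrow> ('a \<Rightarrow> 'a) \<Rightarrow> 'a \<Rightarrow> 'a" where
  "vector_field_bracket X Y p =
     frechet_derivative Y (at p) (X p) - frechet_derivative X (at p) (Y p)"

definition left_invariant_field :: "'a::euclidean_space monoid \<Rightarrow> 'a \<Rightarrow> 'a \<Rightarrow> 'a" where
  "left_invariant_field G v g = frechet_derivative (\<lambda>h. g \<otimes>\<^bsub>G\<^esub> h) (at \<one>\<^bsub>G\<^esub>) v"

definition lie_algebra_bracket :: "'a::euclidean_space monoid \<Rightarrow> 'a \<Rightarrow> 'a \<Rightarrow> 'a" where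
  "lie_algebra_bracket G v w =
     vector_field_bracket (left_invariant_field G v) (left_invariant_field G w) \<one>\<^bsub>G\<^esub>"

definition alpha_map ::
    "('a::real_vector \<Rightarrow> 'a \<Rightarrow> 'a) \<Rightarrow> ('a \<Rightarrow> 'a \<Rightarrow> 'a) \<Rightarrow> 'a \<Rightarrow> 'a \<Rightarrow> 'a" where
  "alpha_map nab nab' x' y = y + nab' y x' - (1/2) *\<^sub>R nab' y (nab y x')"

definition beta_map ::
    "('a::real_vector \<Rightarrow> 'a \<Rightarrow> 'a) \<Rightarrow> ('a \<Rightarrow> 'a \<Rightarrow> 'a) \<Rightarrow> 'a \<Rightarrow> 'a \<Rightarrow> 'a" where
  "beta_map nab nab' x' y = x' - nab x' y - (1/2) *\<^sub>R nab x' (nab' x' y)"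

definition affine_double_group ::
    "('a::real_vector \<Rightarrow> 'a \<Rightarrow> 'a) \<Rightarrow> ('a \<Rightarrow> 'a \<Rightarrow> 'a) \<Rightarrow> ('a \<times> 'a) monoid" where
  "affine_double_group nab nab' =
     \<lparr>carrier = UNIV,
      mult = (\<lambda>(x, x') (y, y'). (x + alpha_map nab nab' x' y, beta_map nab nab' x' y + y')),
      one = (0, 0)\<rparr>"

end

theory Submission
  imports Defs
begin

text \<open>
  Write \<open>xy = \<nabla>\<^sub>x y\<close>. Commutativity and commuting multiplications make this product
  associative, so \<open>\<nabla>\<^sub>x \<nabla>\<^sub>y\<close> is again a multiplication operator \<open>\<nabla>\<^bsub>xy\<^esub>\<close>. Compatibility says that
  multiplication operators are skew for \<open>\<omega>\<close>, whereas the product of two commuting skew operators is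
  self-adjoint; hence \<open>\<nabla>\<^sub>x \<nabla>\<^sub>y = 0\<close>, and likewise for \<open>\<nabla>'\<close>. The mixed condition makes
  \<open>T(x,y,z) = \<nabla>\<^sub>x \<nabla>'\<^sub>y z\<close> totally symmetric, and then
  \<open>\<omega>(T(x,y,z), w) = \<omega>(\<nabla>\<^sub>x w, \<nabla>'\<^sub>y z)\<close> is symmetric in all four arguments. Exchanging the
  two factors yields \<open>\<nabla>'\<^sub>x \<nabla>\<^sub>y z = - T(x,y,z)\<close>, and as a consequence every product of three of
  the operators \<open>\<nabla>\<^sub>x\<close>, \<open>\<nabla>'\<^sub>y\<close> vanishes.

  With these rules (\<open>nab_nab\<close>, \<open>triple_sym\<close>, \<open>nab'_nab\<close>) the group multiplication is the
  polynomial map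
  \<open>(x + y + \<nabla>'\<^sub>y x' + T(y,y,x')/2, x' + y' - \<nabla>\<^bsub>x'\<^esub> y - T(x',x',y)/2)\<close>,
  the group axioms become identities between
  normal forms, and smoothness holds because all maps involved are built from linear and
  bilinear ones. For nilpotency, \<open>(x,x') \<mapsto> (\<nabla>'\<^sub>x, \<nabla>\<^bsub>x'\<^esub>)\<close> is a homomorphism to an additive
  group, so commutators lie in its kernel; commutators with elements of the kernel lie in the
  set of pairs annihilated by both structures, which is central.
\<close>

section \<open>Smooth maps on a Euclidean space\<close>

lemma Ck_on_open_const: "Ck_on_open k UNIV (\<lambda>x. c)"
  by (induction k arbitrary: c) simp_all

lemma Ck_on_open_Suc_D:
  "Ck_on_open (Suc k) UNIV f \<Longrightarrow> Ck_on_open k UNIV f"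
proof (induction k arbitrary: f)
  case 0
  then show ?case
    by (auto simp: continuous_on_eq_continuous_at intro: differentiable_imp_continuous_within)
next
  case (Suc k)
  from Suc.prems have "f differentiable at x" for x by simp
  moreover from Suc.prems have "Ck_on_open k UNIV (\<lambda>x. frechet_derivative f (at x) v)" for v
    using Suc.IH by (subst (asm) Ck_on_open.simps(2)) blast
  ultimately show ?case by simp
qed

lemma Ck_on_open_SucI:
  assumes "\<And>x. (f has_derivative f' x) (at x)" and "\<And>v. Ck_on_open k UNIV (\<lambda>x. f' x v)"
  shows "Ck_on_open (Suc k) UNIV f"
proof -
  have "frechet_derivative f (at x) = f' x" for x
    using frechet_derivative_at[OF assms(1)] by simp
  then show ?thesis using assms by (auto simp: differentiable_def)
qed

lemma Ck_on_open_Suc_has_derivative: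
  "Ck_on_open (Suc k) UNIV f \<Longrightarrow> (f has_derivative frechet_derivative f (at x)) (at x)"
  by (simp add: frechet_derivative_works[symmetric])

lemma Ck_on_open_bounded_linear:
  "bounded_linear f \<Longrightarrow> Ck_on_open k UNIV f"
proof (cases k)
  case 0
  assume "bounded_linear f"
  then show ?thesis using 0 by (simp add: linear_continuous_on)
next
  case (Suc j)
  assume "bounded_linear f"
  then show ?thesis unfolding Suc
    by (intro Ck_on_open_SucI[where f' = "\<lambda>_. f"] bounded_linear_imp_has_derivative Ck_on_open_const)
qed

lemma Ck_on_open_linear_compose:
  assumes L: "bounded_linear L"
  shows "Ck_on_open k UNIV f \<Longrightarrow> Ck_on_open k UNIV (\<lambda>x. L (f x))"
proof (induction k arbitrary: f)
  case 0
  then show ?case using bounded_linear.continuous_on[OF L] by simp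
next
  case (Suc k)
  show ?case
  proof (rule Ck_on_open_SucI)
    show "((\<lambda>x. L (f x)) has_derivative (\<lambda>v. L (frechet_derivative f (at x) v))) (at x)" for x
      using bounded_linear.has_derivative[OF L Ck_on_open_Suc_has_derivative[OF Suc.prems]] .
    show "Ck_on_open k UNIV (\<lambda>x. L (frechet_derivative f (at x) v))" for v
      using Suc by simp
  qed
qed

lemma Ck_on_open_add:
  "Ck_on_open k UNIV f \<Longrightarrow> Ck_on_open k UNIV g \<Longrightarrow> Ck_on_open k UNIV (\<lambda>x. f x + g x)"
proof (induction k arbitrary: f g)
  case 0
  then show ?case by (simp add: continuous_on_add)
next
  case (Suc k)
  show ?case
  proof (rule Ck_on_open_SucI)
    show "((\<lambda>x. f x + g x) has_derivative
        (\<lambda>v. frechet_derivative f (at x) v + frechet_derivative g (at x) v)) (at x)" for x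
      using Suc.prems[THEN Ck_on_open_Suc_has_derivative] by (rule has_derivative_add)
    show "Ck_on_open k UNIV
        (\<lambda>x. frechet_derivative f (at x) v + frechet_derivative g (at x) v)" for v
      using Suc by simp
  qed
qed

lemma Ck_on_open_diff:
  assumes "Ck_on_open k UNIV f" "Ck_on_open k UNIV g"
  shows "Ck_on_open k UNIV (\<lambda>x. f x - g x)"
  using Ck_on_open_add[OF assms(1) Ck_on_open_linear_compose[OF bounded_linear_minus[OF
    bounded_linear_ident] assms(2)]] by simp

lemma Ck_on_open_Pair:
  "Ck_on_open k UNIV f \<Longrightarrow> Ck_on_open k UNIV g \<Longrightarrow> Ck_on_open k UNIV (\<lambda>x. (f x, g x))"
proof (induction k arbitrary: f g)
  case 0
  then show ?case by (simp add: continuous_on_Pair)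
next
  case (Suc k)
  show ?case
  proof (rule Ck_on_open_SucI)
    show "((\<lambda>x. (f x, g x)) has_derivative
        (\<lambda>v. (frechet_derivative f (at x) v, frechet_derivative g (at x) v))) (at x)" for x
      using Suc.prems[THEN Ck_on_open_Suc_has_derivative] by (rule has_derivative_Pair)
    show "Ck_on_open k UNIV
        (\<lambda>x. (frechet_derivative f (at x) v, frechet_derivative g (at x) v))" for v
      using Suc by simp
  qed
qed

lemma Ck_on_open_bilinear:
  assumes h: "bounded_bilinear h"
  shows "Ck_on_open k UNIV f \<Longrightarrow> Ck_on_open k UNIV g \<Longrightarrow> Ck_on_open k UNIV (\<lambda>x. h (f x) (g x))"
proof (induction k arbitrary: f g)
  case 0
  then show ?case using bounded_bilinear.continuous_on[OF h] by simp
next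
  case (Suc k)
  show ?case
  proof (rule Ck_on_open_SucI)
    show "((\<lambda>x. h (f x) (g x)) has_derivative
        (\<lambda>v. h (f x) (frechet_derivative g (at x) v) + h (frechet_derivative f (at x) v) (g x)))
        (at x)" for x
      using Suc.prems[THEN Ck_on_open_Suc_has_derivative] by (rule bounded_bilinear.FDERIV[OF h])
    show "Ck_on_open k UNIV
        (\<lambda>x. h (f x) (frechet_derivative g (at x) v) + h (frechet_derivative f (at x) v) (g x))" for v
      using Suc.prems by (intro Ck_on_open_add Suc.IH) (auto intro: Ck_on_open_Suc_D)
  qed
qed

lemma smooth_map_onI:
  assumes "\<And>k. Ck_on_open k UNIV g" "\<And>x. x \<in> S \<Longrightarrow> g x = f x"
  shows "smooth_map_on S f"
  unfolding smooth_map_on_def using assms by (intro ballI exI[of _ UNIV] exI[of _ g]) auto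

lemma embedded_submanifold_subspace:
  assumes "subspace S"
  shows "embedded_submanifold S"
proof -
  have "Ck_on_open k UNIV (\<lambda>x::'a. x)" for k
    by (rule Ck_on_open_bounded_linear[OF bounded_linear_ident])
  then have "smooth_map_on UNIV (\<lambda>x::'a. x)" and "smooth_map_on UNIV (inv_into UNIV (\<lambda>x::'a. x))"
    by (auto intro!: smooth_map_onI simp: inv_f_eq)
  then have "diffeomorphism_on UNIV UNIV (\<lambda>x::'a. x)"
    by (simp add: diffeomorphism_on_def bij_betw_def)
  then show ?thesis
    unfolding embedded_submanifold_def using assms
    by (intro exI[of _ S] conjI ballI exI[of _ UNIV] exI[of _ "\<lambda>x. x"]) auto
qed

section \<open>The lower central series\<close>

lemma (in group) lower_central_series_Suc_subset:
  assumes "subgroup H G"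
    and "\<And>g h. h \<in> lower_central_series G k \<Longrightarrow> g \<otimes> h \<otimes> inv g \<otimes> inv h \<in> H"
  shows "lower_central_series G (Suc k) \<subseteq> H"
  unfolding lower_central_series.simps
  by (rule generate_subgroup_incl[OF _ assms(1)]) (use assms(2) in blast)

section \<open>Identities for a compatible pair of affine structures\<close>

text \<open>The hypotheses on the two structures; the mixed condition is stated pointwise.\<close>

locale compatible_affine_pair =
  fixes \<omega> :: "'a::real_vector \<Rightarrow> 'a \<Rightarrow> real" and nab nab' :: "'a \<Rightarrow> 'a \<Rightarrow> 'a"
  assumes symplectic: "symplectic_form \<omega>"
    and affine: "affine_structure nab" and affine': "affine_structure nab'"
    and compatible: "compatible nab \<omega>" and compatible': "compatible nab' \<omega>"
    and mixed: "\<And>x y z. nab x (nab' y z) = nab y (nab' x z)"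

lemma symplectic_form_eqI:
  assumes "symplectic_form \<omega>" "\<And>w. \<omega> x w = \<omega> y w"
  shows "x = y"
proof -
  have bil: "bilinear \<omega>" and nondeg: "\<And>u. \<forall>w. \<omega> u w = 0 \<Longrightarrow> u = 0"
    using assms(1) unfolding symplectic_form_def by blast+
  have "x - y = 0"
    by (rule nondeg) (simp add: bilinear_lsub[OF bil] assms(2))
  then show ?thesis by simp
qed

text \<open>\<open>\<nabla>\<^sub>x \<nabla>\<^sub>y = \<nabla>\<^bsub>\<nabla>\<^sub>x y\<^esub>\<close> is both skew and self-adjoint with respect to \<open>\<omega>\<close>.\<close>

lemma compatible_affine_square_zero:
  assumes \<omega>: "symplectic_form \<omega>" and aff: "affine_structure nab" and comp: "compatible nab \<omega>"
  shows "nab x (nab y z) = 0"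
proof -
  have sk: "\<omega> u v = - \<omega> v u" and bil: "bilinear \<omega>" for u v
    using \<omega> unfolding symplectic_form_def by blast+
  have sym: "nab u v = nab v u" for u v using aff by (auto simp: affine_structure_def)
  have comm: "nab u (nab v w) = nab v (nab u w)" for u v w
    using aff by (auto simp: affine_structure_def fun_eq_iff)
  have cp: "\<omega> (nab u v) w = \<omega> (nab u w) v" for u v w
    using comp by (auto simp: compatible_def)
  have "\<omega> (nab x (nab y z)) w = 0" for w
  proof -
    have "\<omega> (nab x (nab y z)) w = \<omega> (nab (nab x y) z) w"
      by (metis sym comm)
    also have "\<dots> = \<omega> (nab (nab x y) w) z" by (rule cp)
    also have "\<dots> = \<omega> (nab y (nab x w)) z"
      by (metis sym comm)
    also have "\<dots> = - \<omega> (nab x (nab y z)) w"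
      by (metis cp sk)
    finally show ?thesis by simp
  qed
  then show ?thesis
    by (intro symplectic_form_eqI[OF \<omega>]) (simp add: bilinear_lzero[OF bil])
qed

context compatible_affine_pair
begin

lemma bilinear_nab: "bilinear nab" and bilinear_nab': "bilinear nab'"
  using affine affine' by (auto simp: affine_structure_def)

lemma nab_sym: "nab x y = nab y x" and nab'_sym: "nab' x y = nab' y x"
  using affine affine' by (auto simp: affine_structure_def)

lemmas nab_linear =
  bilinear_ladd[OF bilinear_nab] bilinear_radd[OF bilinear_nab]
  bilinear_lsub[OF bilinear_nab] bilinear_rsub[OF bilinear_nab]
  bilinear_lneg[OF bilinear_nab] bilinear_rneg[OF bilinear_nab]
  bilinear_lmul[OF bilinear_nab] bilinear_rmul[OF bilinear_nab]
  bilinear_lzero[OF bilinear_nab] bilinear_rzero[OF bilinear_nab]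
  bilinear_ladd[OF bilinear_nab'] bilinear_radd[OF bilinear_nab']
  bilinear_lsub[OF bilinear_nab'] bilinear_rsub[OF bilinear_nab']
  bilinear_lneg[OF bilinear_nab'] bilinear_rneg[OF bilinear_nab']
  bilinear_lmul[OF bilinear_nab'] bilinear_rmul[OF bilinear_nab']
  bilinear_lzero[OF bilinear_nab'] bilinear_rzero[OF bilinear_nab']

lemma nab_nab: "nab x (nab y z) = 0" "nab (nab x y) z = 0"
  using compatible_affine_square_zero[OF symplectic affine compatible] nab_sym by metis+

lemma nab'_nab': "nab' x (nab' y z) = 0" "nab' (nab' x y) z = 0"
  using compatible_affine_square_zero[OF symplectic affine' compatible'] nab'_sym by metis+

text \<open>The trilinear map \<open>T\<close> to which all mixed products of two operators reduce.\<close>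

definition triple :: "'a \<Rightarrow> 'a \<Rightarrow> 'a \<Rightarrow> 'a" where
  "triple x y z = nab x (nab' y z)"

lemma triple_sym: "triple x y z = triple y x z" "triple x y z = triple x z y"
  unfolding triple_def by (rule mixed) (simp add: nab'_sym)

lemma triple_linear:
  "triple (x + y) u v = triple x u v + triple y u v"
  "triple u (x + y) v = triple u x v + triple u y v"
  "triple u v (x + y) = triple u v x + triple u v y"
  "triple (x - y) u v = triple x u v - triple y u v"
  "triple u (x - y) v = triple u x v - triple u y v"
  "triple u v (x - y) = triple u v x - triple u v y"
  "triple (- x) u v = - triple x u v"
  "triple u (- x) v = - triple u x v"
  "triple u v (- x) = - triple u v x"
  "triple (c *\<^sub>R x) u v = c *\<^sub>R triple x u v"
  "triple u (c *\<^sub>R x) v = c *\<^sub>R triple u x v"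
  "triple u v (c *\<^sub>R x) = c *\<^sub>R triple u v x"
  "triple 0 u v = 0" "triple u 0 v = 0" "triple u v 0 = 0"
  by (simp_all add: triple_def nab_linear)

lemma nab_nab': "nab x (nab' y z) = triple x y z" "nab (nab' y z) x = triple x y z"
  by (simp_all add: triple_def nab_sym)

text \<open>
  Exchanging the roles of the two structures changes the sign, because it exchanges the two
  entries of the skew form in \<open>\<omega>(T(x,y,z), w) = \<omega>(\<nabla>\<^sub>x w, \<nabla>'\<^sub>y z)\<close>.
\<close>

lemma nab'_nab: "nab' x (nab y z) = - triple x y z" "nab' (nab y z) x = - triple x y z"
proof -
  have sk: "\<omega> u v = - \<omega> v u" and bil: "bilinear \<omega>" for u v
    using symplectic unfolding symplectic_form_def by blast+
  have cp: "\<omega> (nab u v) w = \<omega> (nab u w) v" "\<omega> (nab' u v) w = \<omega> (nab' u w) v" for u v w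
    using compatible compatible' by (auto simp: compatible_def)
  have T: "\<omega> (triple u v w) t = \<omega> (nab u t) (nab' v w)" for u v w t
    unfolding triple_def by (rule cp)
  have *: "nab' x (nab y z) = - triple x y z" for x y z
  proof (rule symplectic_form_eqI[OF symplectic])
    fix w
    have "\<omega> (nab' x (nab y z)) w = - \<omega> (nab y z) (nab' x w)"
      by (metis cp sk)
    also have "\<dots> = - \<omega> (triple y x w) z" by (simp add: T)
    also have "\<dots> = - \<omega> (triple w x y) z" by (metis triple_sym)
    \<comment> \<open>\<open>\<nabla>\<^sub>w z = \<nabla>\<^sub>z w\<close> exchanges the fourth argument
      of the quartic form with one of the first three\<close>
    also have "\<dots> = - \<omega> (nab z w) (nab' x y)" by (simp add: T nab_sym)
    also have "\<dots> = - \<omega> (triple z x y) w" by (simp add: T)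
    also have "\<dots> = - \<omega> (triple x y z) w" by (metis triple_sym)
    finally show "\<omega> (nab' x (nab y z)) w = \<omega> (- triple x y z) w"
      by (simp add: bilinear_lneg[OF bil])
  qed
  show "nab' x (nab y z) = - triple x y z" by (rule *)
  show "nab' (nab y z) x = - triple x y z" by (subst nab'_sym) (rule *)
qed

lemma nab_triple:
  "nab x (triple y z w) = 0" "nab (triple y z w) x = 0"
  "nab' x (triple y z w) = 0" "nab' (triple y z w) x = 0"
proof -
  have "nab' x (triple y z w) = - nab' x (nab' y (nab z w))"
    by (simp add: nab'_nab nab_linear)
  then show "nab' x (triple y z w) = 0" by (simp add: nab'_nab')
  then show "nab' (triple y z w) x = 0" by (subst nab'_sym)
qed (simp_all add: triple_def nab_nab)

lemma triple_nab:
  "triple (nab x y) z w = 0" "triple z (nab x y) w = 0" "triple z w (nab x y) = 0"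
  "triple (nab' x y) z w = 0" "triple z (nab' x y) w = 0" "triple z w (nab' x y) = 0"
  "triple (triple x y u) z w = 0" "triple z (triple x y u) w = 0" "triple z w (triple x y u) = 0"
proof -
  have "triple z (nab' x y) w = 0" by (simp add: triple_def nab'_nab' nab_linear)
  moreover have "triple (nab x y) z w = 0" by (simp add: triple_def nab_nab)
  moreover have "triple (triple x y u) z w = 0"
    unfolding triple_def[of "triple x y u"] by (rule nab_triple)
  ultimately show
    "triple (nab x y) z w = 0" "triple z (nab x y) w = 0" "triple z w (nab x y) = 0"
    "triple (nab' x y) z w = 0" "triple z (nab' x y) w = 0" "triple z w (nab' x y) = 0"
    "triple (triple x y u) z w = 0" "triple z (triple x y u) w = 0" "triple z w (triple x y u) = 0"
    by (metis triple_sym)+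
qed

text \<open>Rewriting with these rules normalises every product of the operators.\<close>

lemmas normalise = nab_linear triple_linear nab_nab nab'_nab' nab_nab' nab'_nab nab_triple triple_nab

section \<open>The group\<close>

abbreviation "G \<equiv> affine_double_group nab nab'"

lemma carrier_G: "carrier G = UNIV" and one_G: "\<one>\<^bsub>G\<^esub> = (0, 0)"
  by (simp_all add: affine_double_group_def)

lemma mult_G:
  "(x, x') \<otimes>\<^bsub>G\<^esub> (y, y') =
    (x + y + nab' y x' + (1/2) *\<^sub>R triple y y x', x' + y' - nab x' y - (1/2) *\<^sub>R triple x' x' y)"
  by (simp add: affine_double_group_def alpha_map_def beta_map_def normalise)

lemma mult_G_assoc: "(p \<otimes>\<^bsub>G\<^esub> q) \<otimes>\<^bsub>G\<^esub> r = p \<otimes>\<^bsub>G\<^esub> (q \<otimes>\<^bsub>G\<^esub> r)"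
proof -
  obtain x x' y y' z z' where [simp]: "p = (x, x')" "q = (y, y')" "r = (z, z')"
    by (cases p, cases q, cases r)
  have half: "a = (1/2) *\<^sub>R a + (1/2) *\<^sub>R a" for a :: 'a
    by (simp add: scaleR_left_distrib[symmetric])
  show ?thesis
    using half[of "triple y z x'"] half[of "triple x' y' z"]
    by (simp add: mult_G normalise scaleR_add_right scaleR_diff_right triple_sym)
qed

text \<open>The left factor is \<open>(0,-x')(-x,0)\<close>, since \<open>(x,x') = (x,0)(0,x')\<close>.\<close>

lemma inverse_mult_G:
  "(- x + nab' x x' - (1/2) *\<^sub>R triple x x x', - x' - nab x' x + (1/2) *\<^sub>R triple x' x' x)
    \<otimes>\<^bsub>G\<^esub> (x, x') = (0, 0)"
proof -
  have half: "a = (1/2) *\<^sub>R a + (1/2) *\<^sub>R a" for a :: 'a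
    by (simp add: scaleR_left_distrib[symmetric])
  show ?thesis
    using half[of "triple x x x'"] half[of "triple x' x' x"]
    by (simp add: mult_G normalise scaleR_add_right scaleR_diff_right triple_sym diff_eq_eq)
qed

lemma group_G: "group G"
proof (rule groupI)
  show "\<exists>q\<in>carrier G. q \<otimes>\<^bsub>G\<^esub> p = \<one>\<^bsub>G\<^esub>" for p
    using inverse_mult_G[of "fst p" "snd p"] by (auto simp: carrier_G one_G)
  show "\<one>\<^bsub>G\<^esub> \<otimes>\<^bsub>G\<^esub> p = p" for p
    by (cases p) (simp add: one_G mult_G normalise)
qed (auto simp: carrier_G mult_G_assoc)

lemma inv_G:
  "inv\<^bsub>G\<^esub> (x, x') =
    (- x + nab' x x' - (1/2) *\<^sub>R triple x x x', - x' - nab x' x + (1/2) *\<^sub>R triple x' x' x)"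
  by (rule group.inv_equality[OF group_G]) (simp_all only: inverse_mult_G one_G carrier_G UNIV_I)

lemma subgroup_left: "subgroup (UNIV \<times> {0}) G"
  by (rule group.subgroupI[OF group_G]) (auto simp: carrier_G mult_G inv_G normalise)

lemma subgroup_right: "subgroup ({0} \<times> UNIV) G"
  by (rule group.subgroupI[OF group_G]) (auto simp: carrier_G mult_G inv_G normalise)

section \<open>Nilpotency\<close>

text \<open>The kernel of the homomorphism \<open>(x,x') \<mapsto> (\<nabla>'\<^sub>x, \<nabla>\<^bsub>x'\<^esub>)\<close>.\<close>

definition kernel1 :: "('a \<times> 'a) set" where
  "kernel1 = {(x, x'). (\<forall>z. nab' x z = 0) \<and> (\<forall>z. nab x' z = 0)}"

text \<open>The pairs annihilated by both structures; they are central by \<open>kernel2_central\<close>.\<close>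

definition kernel2 :: "('a \<times> 'a) set" where
  "kernel2 = {(x, x'). (\<forall>z. nab x z = 0 \<and> nab' x z = 0) \<and> (\<forall>z. nab x' z = 0 \<and> nab' x' z = 0)}"

lemma nab_annihilator:
  assumes "\<And>z. nab u z = 0"
  shows "nab z u = 0" "triple u z w = 0" "triple z u w = 0" "triple z w u = 0"
proof -
  have "triple u z w = 0" for z w using assms by (simp add: triple_def)
  then show "triple u z w = 0" "triple z u w = 0" "triple z w u = 0"
    using triple_sym by metis+
qed (use assms nab_sym in metis)

lemma nab'_annihilator:
  assumes "\<And>z. nab' u z = 0"
  shows "nab' z u = 0" "triple u z w = 0" "triple z u w = 0" "triple z w u = 0"
proof -
  have "triple z u w = 0" for z w using assms by (simp add: triple_def normalise)
  then show "triple u z w = 0" "triple z u w = 0" "triple z w u = 0"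
    using triple_sym by metis+
qed (use assms nab'_sym in metis)

lemma subgroup_kernel1: "subgroup kernel1 G"
  by (rule group.subgroupI[OF group_G])
    (auto simp: kernel1_def carrier_G mult_G inv_G normalise nab_annihilator nab'_annihilator
      intro!: exI[of _ 0])

lemma subgroup_kernel2: "subgroup kernel2 G"
  by (rule group.subgroupI[OF group_G])
    (auto simp: kernel2_def carrier_G mult_G inv_G normalise nab_annihilator nab'_annihilator
      intro!: exI[of _ 0])

lemma kernel2_mult:
  assumes "(c, c') \<in> kernel2"
  shows "(c, c') \<otimes>\<^bsub>G\<^esub> (x, x') = (c + x, c' + x')"
    and "(x, x') \<otimes>\<^bsub>G\<^esub> (c, c') = (c + x, c' + x')"
proof -
  have c: "\<And>z. nab c z = 0" "\<And>z. nab' c z = 0" "\<And>z. nab c' z = 0" "\<And>z. nab' c' z = 0"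
    using assms by (auto simp: kernel2_def)
  note s = c nab_annihilator[OF c(1)] nab_annihilator[OF c(3)]
    nab'_annihilator(1)[OF c(2)] nab'_annihilator(1)[OF c(4)]
  show "(c, c') \<otimes>\<^bsub>G\<^esub> (x, x') = (c + x, c' + x')"
    "(x, x') \<otimes>\<^bsub>G\<^esub> (c, c') = (c + x, c' + x')"
    by (simp_all add: mult_G s)
qed

lemma kernel2_central: "c \<in> kernel2 \<Longrightarrow> g \<otimes>\<^bsub>G\<^esub> c = c \<otimes>\<^bsub>G\<^esub> g"
  by (cases c, cases g) (simp add: kernel2_mult)

lemma commutator_eqI:
  assumes "g \<otimes>\<^bsub>G\<^esub> h = c \<otimes>\<^bsub>G\<^esub> (h \<otimes>\<^bsub>G\<^esub> g)"
  shows "g \<otimes>\<^bsub>G\<^esub> h \<otimes>\<^bsub>G\<^esub> inv\<^bsub>G\<^esub> g \<otimes>\<^bsub>G\<^esub> inv\<^bsub>G\<^esub> h = c"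
proof -
  interpret group G by (rule group_G)
  show ?thesis using assms by (simp add: carrier_G m_assoc)
qed

lemma commutator_in_kernel1:
  "g \<otimes>\<^bsub>G\<^esub> h \<otimes>\<^bsub>G\<^esub> inv\<^bsub>G\<^esub> g \<otimes>\<^bsub>G\<^esub> inv\<^bsub>G\<^esub> h \<in> kernel1"
  by (cases g, cases h) (simp add: kernel1_def mult_G inv_G normalise)

lemma commutator_in_kernel2:
  assumes "h \<in> kernel1"
  shows "g \<otimes>\<^bsub>G\<^esub> h \<otimes>\<^bsub>G\<^esub> inv\<^bsub>G\<^esub> g \<otimes>\<^bsub>G\<^esub> inv\<^bsub>G\<^esub> h \<in> kernel2"
proof -
  obtain x x' y y' where [simp]: "g = (x, x')" "h = (y, y')" by (cases g, cases h)
  have h: "\<And>z. nab' y z = 0" "\<And>z. nab y' z = 0"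
    using assms by (auto simp: kernel1_def)
  note s = h nab'_annihilator[OF h(1)] nab_annihilator[OF h(2)]
  \<comment> \<open>the cubic terms of \<open>gh\<close> and \<open>hg\<close> vanish,
    and this element is the difference \<open>gh - hg\<close>\<close>
  have c: "(- nab' x y', - nab x' y) \<in> kernel2"
    by (simp add: kernel2_def normalise s)
  have "g \<otimes>\<^bsub>G\<^esub> h = (- nab' x y', - nab x' y) \<otimes>\<^bsub>G\<^esub> (h \<otimes>\<^bsub>G\<^esub> g)"
    unfolding \<open>g = _\<close> \<open>h = _\<close> mult_G[of x x' y y'] mult_G[of y y' x x'] kernel2_mult[OF c]
    by (simp add: s normalise)
  from commutator_eqI[OF this] c show ?thesis by simp
qed

lemma nilpotent_G: "nilpotent_of_step_le 3 G"
proof -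
  interpret group G by (rule group_G)
  have 1: "lower_central_series G (Suc 0) \<subseteq> kernel1"
    by (rule lower_central_series_Suc_subset[OF subgroup_kernel1 commutator_in_kernel1])
  have 2: "lower_central_series G (Suc (Suc 0)) \<subseteq> kernel2"
    by (rule lower_central_series_Suc_subset[OF subgroup_kernel2 commutator_in_kernel2])
      (use 1 in blast)
  have 3: "lower_central_series G (Suc (Suc (Suc 0))) \<subseteq> {\<one>\<^bsub>G\<^esub>}"
  proof (rule lower_central_series_Suc_subset[OF triv_subgroup])
    fix g h assume "h \<in> lower_central_series G (Suc (Suc 0))"
    with 2 have "h \<in> kernel2" by blast
    then have "g \<otimes>\<^bsub>G\<^esub> h = \<one>\<^bsub>G\<^esub> \<otimes>\<^bsub>G\<^esub> (h \<otimes>\<^bsub>G\<^esub> g)"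
      using kernel2_central[of h g] by (simp add: carrier_G)
    then show "g \<otimes>\<^bsub>G\<^esub> h \<otimes>\<^bsub>G\<^esub> inv\<^bsub>G\<^esub> g \<otimes>\<^bsub>G\<^esub> inv\<^bsub>G\<^esub> h \<in> {\<one>\<^bsub>G\<^esub>}"
      using commutator_eqI by blast
  qed
  have "\<one>\<^bsub>G\<^esub> \<in> lower_central_series G (Suc (Suc (Suc 0)))"
    unfolding lower_central_series.simps(2)[of _ "Suc (Suc 0)"] by (rule generate.one)
  with 3 show ?thesis
    unfolding nilpotent_of_step_le_def numeral_3_eq_3 by blast
qed

end

section \<open>Smooth structure and Lie algebra\<close>

locale compatible_affine_pair_euclidean = compatible_affine_pair \<omega> nab nab'
  for \<omega> :: "'a::euclidean_space \<Rightarrow> 'a \<Rightarrow> real" and nab nab'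
begin

lemma bounded_bilinear_nab: "bounded_bilinear nab" "bounded_bilinear nab'"
  using bilinear_nab bilinear_nab' by (simp_all add: bilinear_conv_bounded_bilinear)

lemmas bounded_linear_nab =
  bounded_bilinear.bounded_linear_left[OF bounded_bilinear_nab(1)]
  bounded_bilinear.bounded_linear_right[OF bounded_bilinear_nab(1)]
  bounded_bilinear.bounded_linear_left[OF bounded_bilinear_nab(2)]
  bounded_bilinear.bounded_linear_right[OF bounded_bilinear_nab(2)]

lemmas smooth_intros =
  Ck_on_open_Pair Ck_on_open_add Ck_on_open_diff
  Ck_on_open_bilinear[OF bounded_bilinear_nab(1)] Ck_on_open_bilinear[OF bounded_bilinear_nab(2)]
  Ck_on_open_linear_compose[OF bounded_linear_scaleR_right]
  Ck_on_open_linear_compose[OF bounded_linear_minus[OF bounded_linear_ident]]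
  Ck_on_open_linear_compose[OF bounded_linear_fst] Ck_on_open_linear_compose[OF bounded_linear_snd]
  Ck_on_open_bounded_linear[OF bounded_linear_fst] Ck_on_open_bounded_linear[OF bounded_linear_snd]

lemma lie_group_G: "lie_group G"
  unfolding lie_group_def
proof (intro conjI)
  show "embedded_submanifold (carrier G)"
    by (simp add: carrier_G embedded_submanifold_subspace)
  show "smooth_map_on (carrier G \<times> carrier G) (\<lambda>(g, h). g \<otimes>\<^bsub>G\<^esub> h)"
  proof (rule smooth_map_onI)
    show "Ck_on_open k UNIV (\<lambda>p. (fst (fst p) + fst (snd p) + nab' (fst (snd p)) (snd (fst p))
        + (1/2) *\<^sub>R nab (fst (snd p)) (nab' (fst (snd p)) (snd (fst p))),
        snd (fst p) + snd (snd p) - nab (snd (fst p)) (fst (snd p))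
        - (1/2) *\<^sub>R nab (snd (fst p)) (nab' (snd (fst p)) (fst (snd p)))))" for k
      by (intro smooth_intros)
  qed (auto simp: mult_G triple_def)
  show "smooth_map_on (carrier G) (\<lambda>g. inv\<^bsub>G\<^esub> g)"
  proof (rule smooth_map_onI)
    show "Ck_on_open k UNIV (\<lambda>p. (- fst p + nab' (fst p) (snd p)
        - (1/2) *\<^sub>R nab (fst p) (nab' (fst p) (snd p)),
        - snd p - nab (snd p) (fst p) + (1/2) *\<^sub>R nab (snd p) (nab' (snd p) (fst p))))" for k
      by (intro smooth_intros)
  qed (auto simp: inv_G triple_def)
qed (rule group_G)

lemma double_lie_group_G: "double_lie_group G (UNIV \<times> {0}) ({0} \<times> UNIV)"
proof -
  \<comment> \<open>On this set the product map is \<open>((x,0),(0,y)) \<mapsto> (x,y)\<close>, so its inverse is linear.\<close>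
  let ?S = "(UNIV \<times> {0}) \<times> ({0} \<times> UNIV) :: (('a \<times> 'a) \<times> ('a \<times> 'a)) set"
  let ?f = "\<lambda>(g, h). g \<otimes>\<^bsub>G\<^esub> h"
  have inj: "inj_on ?f ?S"
    by (auto simp: inj_on_def mult_G normalise)
  have bij: "bij_betw ?f ?S (carrier G)"
    unfolding bij_betw_def
  proof (intro conjI inj)
    have "p \<in> ?f ` ?S" for p
      by (rule image_eqI[where x = "((fst p, 0), (0, snd p))"]) (simp_all add: mult_G normalise)
    then show "?f ` ?S = carrier G" by (auto simp: carrier_G)
  qed
  have inv: "inv_into ?S ?f p = ((fst p, 0), (0, snd p))" for p
    by (rule inv_into_f_eq[OF inj]) (simp_all add: mult_G normalise)
  have "smooth_map_on ?S ?f"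
    using lie_group_G unfolding lie_group_def smooth_map_on_def carrier_G by fastforce
  moreover have "smooth_map_on (carrier G) (inv_into ?S ?f)"
  proof (rule smooth_map_onI)
    show "Ck_on_open k UNIV (\<lambda>p::'a \<times> 'a. ((fst p, 0::'a), (0::'a, snd p)))" for k
      by (intro smooth_intros Ck_on_open_const)
  qed (simp add: inv)
  moreover have "subspace ((UNIV :: 'a set) \<times> {0::'a})" "subspace ({0::'a} \<times> (UNIV :: 'a set))"
    by (simp_all add: subspace_Times)
  ultimately show ?thesis
    using bij lie_group_G subgroup_left subgroup_right
    by (simp add: double_lie_group_def lie_subgroup_def diffeomorphism_on_def
        embedded_submanifold_subspace)
qed

lemma left_invariant_field_G:
  "left_invariant_field G (y, y') =
    (\<lambda>p. (y + nab' y (snd p), y' - nab (snd p) y - (1/2) *\<^sub>R nab (snd p) (nab' (snd p) y)))"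
proof
  fix p :: "'a \<times> 'a"
  let ?D = "\<lambda>v. (fst v + nab' (fst v) (snd p),
    snd v - nab (snd p) (fst v) - (1/2) *\<^sub>R nab (snd p) (nab' (snd p) (fst v)))"
  have eq: "(\<lambda>h. p \<otimes>\<^bsub>G\<^esub> h) = (\<lambda>h. (fst p + fst h + nab' (fst h) (snd p)
      + (1/2) *\<^sub>R nab (fst h) (nab' (fst h) (snd p)),
      snd p + snd h - nab (snd p) (fst h) - (1/2) *\<^sub>R nab (snd p) (nab' (snd p) (fst h))))"
    by (cases p) (auto simp: fun_eq_iff mult_G triple_def)
  have "((\<lambda>h. p \<otimes>\<^bsub>G\<^esub> h) has_derivative ?D) (at (0, 0))"
    unfolding eq
    by (rule has_derivative_eq_rhs,
        (rule derivative_intros bounded_bilinear.FDERIV[OF bounded_bilinear_nab(1)]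
          bounded_bilinear.FDERIV[OF bounded_bilinear_nab(2)])+)
      (simp add: fun_eq_iff normalise)
  then show "left_invariant_field G (y, y') p =
      (y + nab' y (snd p), y' - nab (snd p) y - (1/2) *\<^sub>R nab (snd p) (nab' (snd p) y))"
    by (simp add: left_invariant_field_def one_G frechet_derivative_at[symmetric])
qed

lemma lie_algebra_bracket_G:
  "lie_algebra_bracket G (x, x') (y, y') = (nab' y x' - nab' x y', nab x y' - nab y x')"
proof -
  have D: "frechet_derivative (left_invariant_field G (y, y')) (at (0, 0)) =
      (\<lambda>v. (nab' y (snd v), - nab (snd v) y))" for y y'
  proof -
    have "(left_invariant_field G (y, y') has_derivative
        (\<lambda>v. (nab' y (snd v), - nab (snd v) y))) (at (0, 0))"
      unfolding left_invariant_field_G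
      by (rule has_derivative_eq_rhs,
          (rule derivative_intros bounded_bilinear.FDERIV[OF bounded_bilinear_nab(1)]
            bounded_bilinear.FDERIV[OF bounded_bilinear_nab(2)])+)
        (simp add: fun_eq_iff normalise)
    then show ?thesis by (rule frechet_derivative_at[symmetric])
  qed
  have at_one: "left_invariant_field G (y, y') (0, 0) = (y, y')" for y y'
    by (simp add: left_invariant_field_G normalise)
  show ?thesis
    by (simp add: lie_algebra_bracket_def vector_field_bracket_def one_G D at_one nab_sym)
qed

end

theorem theorem2p1:
  fixes n :: nat
    and \<omega> :: "real ^ 'm \<Rightarrow> real ^ 'm \<Rightarrow> real"
    and nab nab' :: "real ^ 'm \<Rightarrow> real ^ 'm \<Rightarrow> real ^ 'm"
  assumes "CARD('m) = 2 * n"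
    and "symplectic_form \<omega>"
    and "affine_structure nab" and "affine_structure nab'"
    and "compatible nab \<omega>" and "compatible nab' \<omega>"
    and "\<forall>x y. nab x \<circ> nab' y = nab y \<circ> nab' x"
  shows "let G = affine_double_group nab nab' in
    lie_group G \<and>
    double_lie_group G (UNIV \<times> {0}) ({0} \<times> UNIV) \<and>
    nilpotent_of_step_le 3 G \<and>
    (\<forall>x x' y y'. lie_algebra_bracket G (x, x') (y, y') =
       (nab' y x' - nab' x y', nab x y' - nab y x'))"
proof -
  interpret compatible_affine_pair_euclidean \<omega> nab nab'
    using assms(2-7) by unfold_locales (simp_all add: fun_eq_iff)
  show ?thesis
    unfolding Let_def
    using lie_group_G double_lie_group_G nilpotent_G lie_algebra_bracket_G by blast
qed

end
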